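(* Suppose that the voltage regulation problem is strictly feasible, i.e., there exists some $q\in\mathbb R^N$ such that $q\in(q^{\min},q^{\max})$ and $v(q)\in(v^{\min},v^{\max})$ (strict componentwise inequalities). Then for any $\epsilon>0$ there exist step-sizes $\alpha,\beta>0$ and $T\in\mathbb N$ such that the iterates $q(t)$ of the VC-LB Algorithm (defined in the context) satisfy $$\mathrm{fes}(q(t))\le\epsilon\quad\text{for all } t\ge T.$$
   Context: Network. Let $N\ge1$, $\mathcal N=\{1,\ldots,N\}$, and let $\mathcal E$ be the directed edge set of a tree on $\{0\}\cup\mathcal N$ rooted at $0$ (edges point from parent to child). Each edge $(h,k)$ has a reactance $x_{hk}>0$. Let $\mathcal P_i\subseteq\mathcal E$ be the set of edges on the path from $0$ to $i$. Define $A\in\mathbb{R}^{N\times N}$ by $A_{ij}=2\sum_{(h,k)\in\mathcal P_i\cap\mathcal P_j}x_{hk}$; it is symmetric positive definite. Voltage regulation problem. Fix $d\in\mathbb R^N$ and vectors $v^{\min},v^{\max},q^{\min},q^{\max}\in\mathbb R^N$. For $q\in\mathbb R^N$ (reactive power injections) let $v(q)=Aq+d$ (squared voltage magnitudes). The problem is to find $q$ with $q^{\min}\le q\le q^{\max}$ and $v^{\min}\le v(q)\le v^{\max}$ (componentwise). Feasibility measure. $\mathrm{fes}(q)=\mathrm{dist}\big((q,v(q)),\mathcal Q\times\mathcal V\big)$, where $\mathcal Q=[q^{\min},q^{\max}]$ and $\mathcal V=[v^{\min},v^{\max}]$ are boxes in $\mathbb R^N$ and $\mathrm{dist}(x,\mathcal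 X)=\inf_{y\in\mathcal X}\|x-y\|$ with the Euclidean norm. VC-LB Algorithm. $\lceil\cdot\rceil_+$ denotes projection onto the nonnegative orthant, and $\mathrm{sign}$ is applied componentwise with values in $\{-1,1\}$ (with $\mathrm{sign}(0)$ a fixed element of $\{-1,1\}$). Given step-sizes $\alpha,\beta>0$, the algorithm maintains dual variables $\lambda(t)=(\lambda^{\min}(t),\lambda^{\max}(t))$ and $\mu(t)=(\mu^{\min}(t),\mu^{\max}(t))$ in $\mathbb R^{2N}_+$, with $\lambda(0)=\mu(0)=0$. For $t=0,1,2,\ldots$ it sets $$q(t)=\lambda^{\min}(t)-\lambda^{\max}(t)+A^{-1}\big(\mu^{\min}(t)-\mu^{\max}(t)\big),$$ $$\lambda^{\min}(t+1)=\lceil\lambda^{\min}(t)+\alpha(v^{\min}-v(q(t)))\rceil_+,\quad \lambda^{\max}(t+1)=\lceil\lambda^{\max}(t)+\alpha(v(q(t))-v^{\max})\rceil_+,$$ $$\mu^{\min}(t+1)=\lceil\mu^{\min}(t)+\beta\,\mathrm{sign}(q^{\min}-q(t))\rceil_+,\quad \mu^{\max}(t+1)=\lceil\mu^{\max}(t)+\beta\,\mathrm{sign}(q(t)-q^{\max})\rceil_+.$$ At each iteration each bus $i$ communicates to its neighbours only the two bits $\mathrm{sign}(q_i^{\min}-q_i(t))$ and $\mathrm{sign}(q_i(t)-q_i^{\max})$. *)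

theory Defs
  imports "HOL-Analysis.Analysis" "Graph_Theory.Pair_Digraph"
begin

text \<open>
  The buses \<open>1, \<dots>, N\<close> are the elements of a finite type \<open>'n\<close> (so \<open>N = CARD('n) \<ge> 1\<close>). The tree
  has the vertices \<open>'n option\<close>: \<open>None\<close> is the root \<open>0\<close> and \<open>Some i\<close> is the bus \<open>i\<close>.
\<close>

definition network :: "('n option \<times> 'n option) set \<Rightarrow> ('n option, 'n option \<times> 'n option) pre_digraph"
  where "network E = with_proj \<lparr>pverts = UNIV, parcs = E\<rparr>"

text \<open>
  A directed tree whose edges point away from its root (an arborescence): every vertex is reached
  from the root by exactly one directed walk. Uniqueness is required for walks rather than for
  paths without repeated vertices, since otherwise edges leading back towards the root would be
  allowed.
\<close>

definition rooted_tree :: "('a, 'b) pre_digraph \<Rightarrow> 'a \<Rightarrow> bool"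
  where "rooted_tree G r \<longleftrightarrow>
    wf_digraph G \<and> r \<in> verts G \<and> (\<forall>v \<in> verts G. \<exists>!p. pre_digraph.awalk G r p v)"

definition path_edges :: "('n option \<times> 'n option) set \<Rightarrow> 'n \<Rightarrow> ('n option \<times> 'n option) set"
  where "path_edges E i = set (THE p. pre_digraph.apath (network E) None p (Some i))"

definition reactance_matrix ::
    "('n option \<times> 'n option) set \<Rightarrow> ('n option \<times> 'n option \<Rightarrow> real) \<Rightarrow> real^'n^'n::finite"
  where "reactance_matrix E x = (\<chi> i j. 2 * (\<Sum>e \<in> path_edges E i \<inter> path_edges E j. x e))"

definition voltage :: "real^'n^'n \<Rightarrow> real^'n \<Rightarrow> real^'n \<Rightarrow> real^'n::finite"
  where "voltage A d q = A *v q + d"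

text \<open>
  The norm on the product type is the Euclidean norm of the concatenated vector of length \<open>2 N\<close>.
\<close>

definition fes :: "real^'n^'n \<Rightarrow> real^'n \<Rightarrow> real^'n \<Rightarrow> real^'n \<Rightarrow> real^'n \<Rightarrow> real^'n \<Rightarrow>
    real^'n::finite \<Rightarrow> real"
  where "fes A d vmin vmax qmin qmax q =
    infdist (q, voltage A d q) (cbox qmin qmax \<times> cbox vmin vmax)"

definition proj_nonneg :: "real^'n \<Rightarrow> real^'n::finite"
  where "proj_nonneg y = (\<chi> i. max 0 (y $ i))"

definition sign_vec :: "real \<Rightarrow> real^'n \<Rightarrow> real^'n::finite"
  where "sign_vec s0 y = (\<chi> i. if y $ i = 0 then s0 else sgn (y $ i))"

record 'n duals =
  lam_min :: "real^'n"
  lam_max :: "real^'n"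
  mu_min :: "real^'n"
  mu_max :: "real^'n"

definition vclb_q :: "real^'n^'n \<Rightarrow> 'n::finite duals \<Rightarrow> real^'n"
  where "vclb_q A s = lam_min s - lam_max s + matrix_inv A *v (mu_min s - mu_max s)"

definition vclb_step :: "real^'n^'n \<Rightarrow> real^'n \<Rightarrow> real^'n \<Rightarrow> real^'n \<Rightarrow> real^'n \<Rightarrow> real^'n \<Rightarrow> real \<Rightarrow>
    real \<Rightarrow> real \<Rightarrow> 'n::finite duals \<Rightarrow> 'n duals"
  where "vclb_step A d vmin vmax qmin qmax s0 \<alpha> \<beta> s = (let q = vclb_q A s; v = voltage A d q in
    \<lparr>lam_min = proj_nonneg (lam_min s + \<alpha> *\<^sub>R (vmin - v)),
     lam_max = proj_nonneg (lam_max s + \<alpha> *\<^sub>R (v - vmax)),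
     mu_min = proj_nonneg (mu_min s + \<beta> *\<^sub>R sign_vec s0 (qmin - q)),
     mu_max = proj_nonneg (mu_max s + \<beta> *\<^sub>R sign_vec s0 (q - qmax))\<rparr>)"

primrec vclb_duals :: "real^'n^'n \<Rightarrow> real^'n \<Rightarrow> real^'n \<Rightarrow> real^'n \<Rightarrow> real^'n \<Rightarrow> real^'n \<Rightarrow> real \<Rightarrow>
    real \<Rightarrow> real \<Rightarrow> nat \<Rightarrow> 'n::finite duals"
  where
    "vclb_duals A d vmin vmax qmin qmax s0 \<alpha> \<beta> 0 =
      \<lparr>lam_min = 0, lam_max = 0, mu_min = 0, mu_max = 0\<rparr>"
  | "vclb_duals A d vmin vmax qmin qmax s0 \<alpha> \<beta> (Suc t) =
      vclb_step A d vmin vmax qmin qmax s0 \<alpha> \<beta> (vclb_duals A d vmin vmax qmin qmax s0 \<alpha> \<beta> t)"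

definition vclb_iterate :: "real^'n^'n \<Rightarrow> real^'n \<Rightarrow> real^'n \<Rightarrow> real^'n \<Rightarrow> real^'n \<Rightarrow> real^'n \<Rightarrow> real \<Rightarrow>
    real \<Rightarrow> real \<Rightarrow> nat \<Rightarrow> real^'n::finite"
  where "vclb_iterate A d vmin vmax qmin qmax s0 \<alpha> \<beta> t =
    vclb_q A (vclb_duals A d vmin vmax qmin qmax s0 \<alpha> \<beta> t)"

end

theory Submission
  imports Defs
begin

text \<open>
  The algorithm is a projected ascent on the Lagrange dual of the strictly convex problem of
  minimizing \<open>q \<bullet> A q / 2\<close> over the feasible set. The injection \<open>q(t)\<close> is the minimizer of the
  Lagrangian for the current multipliers, so the constraint violations \<open>vmin - v\<close>, \<open>v - vmax\<close>,
  \<open>qmin - q\<close>, \<open>q - qmax\<close> are the partial derivatives of the dual function. The multipliers \<open>\<lambda>\<close>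
  follow the gradient and the multipliers \<open>\<mu>\<close> follow only its sign. After a change of sign one
  minimizes the convex function \<open>dual y = y \<bullet> K y / 2 - c \<bullet> y\<close> over the nonnegative orthant.

  Let \<open>p\<close> be the inner product of the gradient of the ascent with the step that is actually
  made. Every coordinate contributes a nonnegative amount to \<open>p\<close>. Two estimates carry the proof,
  and both are part of \<open>one_step_progress\<close>. The step lowers \<open>dual\<close> by at least \<open>p / 2\<close>, up to a
  curvature error of order \<open>\<beta>\<^sup>2\<close> caused by the sign coordinates. The optimality gap is at most of
  order \<open>p / \<beta> + sqrt p\<close>, by convexity and because multipliers on a sublevel set are bounded. If
  the gap exceeds a suitable multiple of \<open>\<beta>\<close>, then \<open>p\<close> is a large enough multiple of \<open>\<beta>\<^sup>2\<close>, so \<open>dual\<close>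
  decreases by at least \<open>\<beta>\<^sup>2\<close>; otherwise \<open>dual\<close> stays within order \<open>\<beta>\<close> of the optimum after the
  step. Hence the gap is eventually of order \<open>\<beta>\<close>, for ever. Strict feasibility enters through
  coercivity: it makes the dual grow linearly on the orthant, which bounds the sublevel sets
  independently of the step-sizes and yields a minimizer.

  A small gap forces a small change of \<open>K y\<close> relative to the minimizer, by the Cauchy-Schwarz
  inequality for the semidefinite form of \<open>K\<close>. Since \<open>K y\<close> contains both \<open>q\<close> and \<open>A q\<close>, and the
  minimizer satisfies all constraints, the distance to the feasible set is small as well.

  The matrix \<open>A\<close> is positive definite because \<open>z \<bullet> A z\<close> is twice the sum over the edges of the
  reactance times the squared total of \<open>z\<close> below the edge. At a deepest bus with a nonzero entry of \<open>z\<close>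
  the edge leading to it carries exactly that entry.
\<close>

section \<open>Projected updates of a single coordinate\<close>

text \<open>
  Here \<open>y\<close> is a multiplier, \<open>g\<close> its partial derivative, \<open>\<Delta>\<close> the step made and \<open>z\<close> the target
  multiplier. Where the projection is inactive, \<open>g * \<Delta>\<close> is \<open>\<alpha> * g\<^sup>2\<close>, and \<open>\<bar>g\<bar>\<close> is recovered as a
  square root. Where it is active, \<open>\<Delta> = - y\<close> and \<open>g\<close> is negative, so the gain towards \<open>z\<close> is at most
  \<open>- g * y\<close>; since \<open>\<alpha> * G \<le> R\<close> keeps this below \<open>R\<^sup>2 / \<alpha>\<close>, it is at most \<open>R / sqrt \<alpha>\<close> times its own
  square root.
\<close>

lemma projected_gradient_coordinate:
  fixes y z g \<alpha> R G :: real
  assumes "0 \<le> y" "y \<le> R" "0 \<le> z" "z \<le> R" "\<bar>g\<bar> \<le> G" "0 < \<alpha>" "\<alpha> * G \<le> R"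
  defines "\<Delta> \<equiv> max 0 (y + \<alpha> * g) - y"
  shows "\<Delta>\<^sup>2 \<le> \<alpha> * (g * \<Delta>)" "g * (z - y) \<le> R * sqrt (g * \<Delta> / \<alpha>)"
proof -
  have R: "0 \<le> R" using assms by linarith
  have "\<Delta>\<^sup>2 \<le> \<alpha> * (g * \<Delta>) \<and> g * (z - y) \<le> R * sqrt (g * \<Delta> / \<alpha>)"
  proof (cases "0 \<le> y + \<alpha> * g")
    case True
    then have \<Delta>: "\<Delta> = \<alpha> * g" by (simp add: \<Delta>_def)
    have "sqrt (g * \<Delta> / \<alpha>) = \<bar>g\<bar>"
      using assms(6) by (simp add: \<Delta> flip: power2_eq_square)
    moreover have "g * (z - y) \<le> \<bar>g\<bar> * R"
    proof -
      have "g * (z - y) \<le> \<bar>g\<bar> * \<bar>z - y\<bar>" by (metis abs_ge_self abs_mult)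
      also have "\<dots> \<le> \<bar>g\<bar> * R" using assms by (intro mult_left_mono) auto
      finally show ?thesis .
    qed
    ultimately show ?thesis by (simp add: \<Delta> power2_eq_square mult.commute)
  next
    case False
    then have \<Delta>: "\<Delta> = - y" by (simp add: \<Delta>_def)
    have g: "g < 0" using False assms(1,6) by (smt (verit) mult_nonneg_nonneg)
    have 1: "y * y \<le> y * (\<alpha> * - g)" using False assms(1) by (intro mult_left_mono) auto
    have gap: "g * (z - y) \<le> - g * y"
      using g assms(3) by (smt (verit) mult_minus_left mult_nonneg_nonneg right_diff_distrib)
    have le: "- g * y \<le> R\<^sup>2 / \<alpha>"
    proof -
      have "\<alpha> * (- g * y) \<le> \<alpha> * (G * R)"
        using assms g by (intro mult_left_mono mult_mono) auto
      also have "\<dots> \<le> R * R" using mult_right_mono[OF assms(7) R] by (simp add: mult.assoc)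
      finally show ?thesis using assms(6) by (simp add: field_simps power2_eq_square)
    qed
    have nn: "0 \<le> - g * y" using g assms(1) by (simp add: mult_nonpos_nonneg)
    have "(- g * y)\<^sup>2 \<le> R\<^sup>2 / \<alpha> * (- g * y)"
      unfolding power2_eq_square[of "- g * y"] using le nn by (rule mult_right_mono)
    then have "sqrt ((- g * y)\<^sup>2) \<le> sqrt (R\<^sup>2 * (- g * y / \<alpha>))"
      by (intro real_sqrt_le_mono) (simp add: field_simps)
    also have "\<dots> = R * sqrt (- g * y / \<alpha>)" using R by (simp only: real_sqrt_mult) simp
    finally have "- g * y \<le> R * sqrt (- g * y / \<alpha>)" using nn by simp
    with gap have "g * (z - y) \<le> R * sqrt (- g * y / \<alpha>)" by linarith
    then show ?thesis using 1 by (simp add: \<Delta> power2_eq_square mult_ac)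
  qed
  then show "\<Delta>\<^sup>2 \<le> \<alpha> * (g * \<Delta>)" "g * (z - y) \<le> R * sqrt (g * \<Delta> / \<alpha>)" by auto
qed

definition sign_with :: "real \<Rightarrow> real \<Rightarrow> real"
  where "sign_with s0 r = (if r = 0 then s0 else sgn r)"

text \<open>
  The counterpart for a sign step. A full step of length \<open>\<beta>\<close> earns \<open>\<beta> * \<bar>g\<bar>\<close>, while the gain towards
  \<open>z\<close> is at most \<open>R * \<bar>g\<bar>\<close>, whence the factor \<open>R / \<beta>\<close>. A step cut short at \<open>0\<close> earns everything that
  could be gained, and \<open>\<beta> \<le> R\<close> makes the same factor sufficient.
\<close>

lemma projected_sign_coordinate:
  fixes y z g \<beta> R s0 :: real
  assumes "0 \<le> y" "y \<le> R" "0 \<le> z" "z \<le> R" "0 < \<beta>" "\<beta> \<le> R" "\<bar>s0\<bar> \<le> 1"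
  defines "\<Delta> \<equiv> max 0 (y + \<beta> * sign_with s0 g) - y"
  shows "\<bar>\<Delta>\<bar> \<le> \<beta>" "0 \<le> g * \<Delta>" "g * (z - y) \<le> R / \<beta> * (g * \<Delta>)"
proof -
  have "\<bar>sign_with s0 g\<bar> \<le> 1" using assms(7) by (simp add: sign_with_def sgn_if)
  then have "\<bar>\<beta> * sign_with s0 g\<bar> \<le> \<beta>" using assms(5) by (simp add: abs_mult)
  then show "\<bar>\<Delta>\<bar> \<le> \<beta>" using assms(1) by (auto simp: \<Delta>_def max_def)
  consider "g = 0" | "g > 0" | "g < 0" "\<beta> \<le> y" | "g < 0" "y < \<beta>" by linarith
  then have "0 \<le> g * \<Delta> \<and> g * (z - y) \<le> R / \<beta> * (g * \<Delta>)"
  proof cases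
    case 2
    then have "\<Delta> = \<beta>" using assms by (simp add: \<Delta>_def sign_with_def)
    moreover have "g * (z - y) \<le> g * R" using 2 assms by (intro mult_left_mono) auto
    ultimately show ?thesis using 2(1) assms(5) by (simp add: mult.commute)
  next
    case 3
    then have \<Delta>: "\<Delta> = - \<beta>" using assms by (simp add: \<Delta>_def sign_with_def)
    have "- g * (y - z) \<le> - g * R" using 3 assms by (intro mult_left_mono) auto
    then show ?thesis using 3(1) assms(5)
      by (auto simp: \<Delta> mult_nonpos_nonneg algebra_simps mult_le_0_iff)
  next
    case 4
    then have \<Delta>: "\<Delta> = - y" using assms by (simp add: \<Delta>_def sign_with_def)
    have nn: "0 \<le> g * \<Delta>" using 4(1) assms(1) by (simp add: \<Delta> mult_nonpos_nonneg)
    have "g * z \<le> 0" using 4(1) assms(3) by (simp add: mult_nonpos_nonneg)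
    then have "g * (z - y) \<le> 1 * (g * \<Delta>)" by (simp add: \<Delta> algebra_simps)
    also have "\<dots> \<le> R / \<beta> * (g * \<Delta>)" using nn assms(5,6) by (intro mult_right_mono) auto
    finally show ?thesis using nn by simp
  qed simp
  then show "0 \<le> g * \<Delta>" "g * (z - y) \<le> R / \<beta> * (g * \<Delta>)" by auto
qed

text \<open>
  A Lyapunov argument for sequences that need not be monotone: above \<open>a\<close> they fall by a fixed
  amount, so by boundedness they come below \<open>b\<close> at some time; from there on, a jump from below \<open>a\<close>
  is caught by \<open>b\<close>.
\<close>

lemma eventually_below_threshold:
  fixes u :: "nat \<Rightarrow> real"
  assumes bound: "\<And>t. L \<le> u t" and "0 < \<gamma>" "a \<le> b"
    and descent: "\<And>t. a < u t \<Longrightarrow> u (Suc t) \<le> u t - \<gamma>"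
    and small: "\<And>t. u t \<le> a \<Longrightarrow> u (Suc t) \<le> b"
  shows "\<exists>T. \<forall>t \<ge> T. u t \<le> b"
proof -
  have stay: "u (Suc t) \<le> b" if "u t \<le> b" for t
    using that descent[of t] small[of t] \<open>0 < \<gamma>\<close> by (cases "a < u t") auto
  have "\<exists>T. u T \<le> b"
  proof (rule ccontr)
    assume "\<not> ?thesis"
    then have high: "a < u t" for t using \<open>a \<le> b\<close> by (meson le_less_trans not_le)
    have dec: "u t \<le> u 0 - real t * \<gamma>" for t
    proof (induction t)
      case (Suc t)
      then show ?case using descent[OF high, of t] by (simp add: algebra_simps)
    qed simp
    obtain t where "u 0 - L < real t * \<gamma>" using \<open>0 < \<gamma>\<close> by (meson reals_Archimedean3)
    with dec[of t] bound[of t] show False by linarith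
  qed
  then obtain T where T: "u T \<le> b" ..
  have "u t \<le> b" if "T \<le> t" for t
    using that by (induction rule: dec_induct) (auto intro: stay T)
  then show ?thesis by blast
qed

section \<open>Convex quadratic duals under mixed gradient and sign ascent\<close>

text \<open>
  Abstractly, the primal data enter the dual only through the Hessian \<open>K\<close> and the linear term
  \<open>c\<close>. The multipliers form a Euclidean space, and each constraint is one coordinate of
  \<open>c - K y \<le> 0\<close>. A strictly feasible primal point appears as a vector \<open>y\<close>, of arbitrary signs, at
  which all these inequalities are strict.
\<close>

locale convex_dual_quadratic =
  fixes K :: "'a::euclidean_space \<Rightarrow> 'a" and c :: 'a
  assumes linear_K: "linear K"
    and selfadjoint: "x \<bullet> K y = K x \<bullet> y"
    and psd: "0 \<le> x \<bullet> K x"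
    and slater: "\<exists>y. \<forall>b\<in>Basis. (c - K y) \<bullet> b < 0"
begin

text \<open>
  The vector of constraint violations at the primal point that belongs to \<open>y\<close>. It is the
  gradient of \<open>- dual\<close>, hence the direction that reduces \<open>dual\<close>.
\<close>

definition slack :: "'a \<Rightarrow> 'a"
  where "slack y = c - K y"

definition dual :: "'a \<Rightarrow> real"
  where "dual y = y \<bullet> K y / 2 - c \<bullet> y"

definition orthant :: "'a set"
  where "orthant = {y. \<forall>b\<in>Basis. 0 \<le> y \<bullet> b}"

definition ascent_step :: "'a set \<Rightarrow> real \<Rightarrow> real \<Rightarrow> real \<Rightarrow> 'a \<Rightarrow> 'a"
  where "ascent_step S s0 \<alpha> \<beta> y = (\<Sum>b\<in>Basis. max 0 (y \<bullet> b +
    (if b \<in> S then \<beta> * sign_with s0 (slack y \<bullet> b) else \<alpha> * (slack y \<bullet> b))) *\<^sub>R b)"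

lemma ascent_step_inner:
  "b \<in> Basis \<Longrightarrow> ascent_step S s0 \<alpha> \<beta> y \<bullet> b = max 0 (y \<bullet> b +
    (if b \<in> S then \<beta> * sign_with s0 (slack y \<bullet> b) else \<alpha> * (slack y \<bullet> b)))"
  by (simp add: ascent_step_def)

lemma dual_expand: "dual (y + h) = dual y - slack y \<bullet> h + h \<bullet> K h / 2"
  using selfadjoint[of y h]
  by (simp add: dual_def slack_def linear_add[OF linear_K] algebra_simps inner_commute add_divide_distrib)

lemma dual_convex: "dual y - dual z \<le> slack y \<bullet> (z - y)"
  using dual_expand[of y "z - y"] psd[of "z - y"] by simp

lemma K_bound: obtains \<kappa> where "\<kappa> > 0" "\<And>x. norm (K x) \<le> \<kappa> * norm x"
  using linear_bounded_pos[OF linear_K] by blast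

text \<open>
  The Cauchy-Schwarz inequality for the semidefinite form of \<open>K\<close>, obtained by testing it on
  \<open>h - K h / \<kappa>\<close>. It turns a small quadratic gap into a small change of all constraint values,
  although \<open>K\<close> is singular in general.
\<close>

lemma norm_K_sq_le:
  assumes "\<kappa> > 0" and \<kappa>: "\<And>x. norm (K x) \<le> \<kappa> * norm x"
  shows "(norm (K h))\<^sup>2 \<le> \<kappa> * (h \<bullet> K h)"
proof -
  let ?s = "1 / \<kappa>"
  have "K h \<bullet> K (K h) \<le> norm (K h) * norm (K (K h))" by (rule norm_cauchy_schwarz)
  also have "\<dots> \<le> norm (K h) * (\<kappa> * norm (K h))" using \<kappa> by (intro mult_left_mono) auto
  finally have 1: "K h \<bullet> K (K h) \<le> \<kappa> * (norm (K h))\<^sup>2" by (simp add: power2_eq_square mult_ac)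
  have "0 \<le> (h - ?s *\<^sub>R K h) \<bullet> K (h - ?s *\<^sub>R K h)" by (rule psd)
  also have "\<dots> = h \<bullet> K h - 2 * ?s * (norm (K h))\<^sup>2 + ?s\<^sup>2 * (K h \<bullet> K (K h))"
    using selfadjoint[of h "K h"] unfolding power2_norm_eq_inner
    by (simp add: linear_diff[OF linear_K] linear_scale[OF linear_K] power2_eq_square algebra_simps)
  also have "\<dots> \<le> h \<bullet> K h - 2 * ?s * (norm (K h))\<^sup>2 + ?s\<^sup>2 * (\<kappa> * (norm (K h))\<^sup>2)"
    using 1 by (intro add_left_mono mult_left_mono) auto
  also have "\<dots> = h \<bullet> K h - (norm (K h))\<^sup>2 / \<kappa>"
    using \<open>\<kappa> > 0\<close> by (simp add: field_simps power2_eq_square)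
  finally show ?thesis using \<open>\<kappa> > 0\<close> by (simp add: field_simps)
qed

text \<open>
  The linear lower bound of \<open>dual\<close> at a strictly feasible \<open>w\<close> has the slope \<open>- slack w\<close>, which is
  positive in every coordinate. So \<open>dual\<close> grows at least linearly on the orthant.
\<close>

lemma dual_coercive:
  obtains \<delta> C where "\<delta> > 0" "\<And>y. y \<in> orthant \<Longrightarrow> \<delta> * norm y - C \<le> dual y"
proof -
  obtain w where w: "\<And>b. b \<in> Basis \<Longrightarrow> slack w \<bullet> b < 0" using slater by (auto simp: slack_def)
  define \<delta> where "\<delta> = Min ((\<lambda>b. - (slack w \<bullet> b)) ` Basis)"
  have \<delta>: "\<delta> > 0" unfolding \<delta>_def by (subst Min_gr_iff) (use w in auto)
  have \<delta>_le: "\<delta> \<le> - (slack w \<bullet> b)" if "b \<in> Basis" for b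
    unfolding \<delta>_def using that by (intro Min_le) auto
  have "\<delta> * norm y - (- dual w - slack w \<bullet> w) \<le> dual y" if y: "y \<in> orthant" for y
  proof -
    have "\<delta> * norm y \<le> \<delta> * (\<Sum>b\<in>Basis. \<bar>y \<bullet> b\<bar>)"
      using norm_le_l1[of y] \<delta> by simp
    also have "\<dots> = (\<Sum>b\<in>Basis. \<delta> * (y \<bullet> b))"
      using y by (simp add: sum_distrib_left orthant_def)
    also have "\<dots> \<le> (\<Sum>b\<in>Basis. - (slack w \<bullet> b) * (y \<bullet> b))"
      using y \<delta>_le by (intro sum_mono mult_right_mono) (auto simp: orthant_def)
    also have "\<dots> = - (slack w \<bullet> y)" by (subst euclidean_inner) (simp add: sum_negf)
    finally show ?thesis using dual_convex[of w y] by (simp add: inner_diff_right)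
  qed
  with \<delta> show ?thesis by (rule that)
qed

lemma dual_minimizer:
  obtains z where "z \<in> orthant" "\<And>y. y \<in> orthant \<Longrightarrow> dual z \<le> dual y"
proof -
  obtain \<delta> C where \<delta>: "\<delta> > 0" and coercive: "\<And>y. y \<in> orthant \<Longrightarrow> \<delta> * norm y - C \<le> dual y"
    by (rule dual_coercive) blast
  have zero: "0 \<in> orthant" "dual 0 = 0" by (auto simp: orthant_def dual_def)
  have "C \<ge> 0" using coercive[OF zero(1)] zero(2) by simp
  \<comment> \<open>on the orthant outside this ball \<open>dual\<close> is positive, hence above its value at \<open>0\<close>\<close>
  let ?B = "orthant \<inter> cball 0 (C / \<delta>)"
  have orthant: "orthant = (\<Inter>b\<in>Basis. {y. 0 \<le> y \<bullet> b})" by (auto simp: orthant_def)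
  have "closed orthant"
    unfolding orthant by (intro closed_INT ballI closed_halfspace_component_ge)
  then have "compact ?B" by (simp add: closed_Int_compact)
  moreover have "continuous_on ?B dual"
    unfolding dual_def
    by (intro continuous_intros linear_continuous_on linear_conv_bounded_linear[THEN iffD1] linear_K) simp
  moreover have "?B \<noteq> {}" using zero \<delta> \<open>C \<ge> 0\<close> by auto
  ultimately obtain z where z: "z \<in> ?B" "\<And>y. y \<in> ?B \<Longrightarrow> dual z \<le> dual y"
    using continuous_attains_inf[of ?B dual] by blast
  have "dual z \<le> dual y" if y: "y \<in> orthant" for y
  proof (cases "y \<in> ?B")
    case False
    then have "\<delta> * norm y > C" using y \<delta> by (simp add: field_simps)
    then have "0 < dual y" using coercive[OF y] by simp
    moreover have "dual z \<le> 0" using z(2)[of 0] zero \<delta> \<open>C \<ge> 0\<close> by auto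
    ultimately show ?thesis by simp
  qed (use z in auto)
  with z(1) show ?thesis using that by blast
qed

text \<open>
  First-order optimality: otherwise a short move from \<open>z\<close> towards \<open>y\<close>, which stays in the orthant,
  would lower \<open>dual\<close>.
\<close>

lemma dual_variational:
  assumes z: "z \<in> orthant" "\<And>y. y \<in> orthant \<Longrightarrow> dual z \<le> dual y" and y: "y \<in> orthant"
  shows "slack z \<bullet> (y - z) \<le> 0"
proof (rule ccontr)
  assume "\<not> ?thesis"
  then have pos: "0 < slack z \<bullet> (y - z)" (is "0 < ?s") by simp
  let ?q = "(y - z) \<bullet> K (y - z)"
  \<comment> \<open>short enough for the linear gain \<open>t * ?s\<close> to beat the curvature loss \<open>t\<^sup>2 * ?q / 2\<close>\<close>
  define t where "t = min 1 (?s / (?q + 1))"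
  have q: "0 \<le> ?q" by (rule psd)
  have t: "0 < t" "t \<le> 1" using pos q by (auto simp: t_def)
  have "t * ?q \<le> ?s / (?q + 1) * ?q" using q by (intro mult_right_mono) (auto simp: t_def)
  also have "\<dots> \<le> ?s" using q pos by (simp add: field_simps)
  finally have tq: "t * ?q / 2 < ?s" using pos by simp
  have "z + t *\<^sub>R (y - z) \<in> orthant"
  proof -
    have "(z + t *\<^sub>R (y - z)) \<bullet> b = (1 - t) * (z \<bullet> b) + t * (y \<bullet> b)" for b
      by (simp add: algebra_simps)
    then show ?thesis using t z(1) y by (simp add: orthant_def)
  qed
  then have "dual z \<le> dual (z + t *\<^sub>R (y - z))" by (rule z(2))
  also have "\<dots> = dual z - t * ?s + t * (t * ?q / 2)"
    unfolding dual_expand by (simp add: linear_scale[OF linear_K])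
  finally have "t * ?s \<le> t * (t * ?q / 2)" by simp
  then show False using t tq by simp
qed

lemma dual_gap_quadratic:
  assumes z: "z \<in> orthant" "\<And>y. y \<in> orthant \<Longrightarrow> dual z \<le> dual y" and y: "y \<in> orthant"
  shows "(y - z) \<bullet> K (y - z) \<le> 2 * (dual y - dual z)"
  using dual_expand[of z "y - z"] dual_variational[OF z y] by simp

text \<open>
  Moving one multiplier of the minimizer upwards stays in the orthant, so no partial derivative
  can be favourable: the minimizer satisfies all constraints.
\<close>

lemma slack_minimizer_nonpos:
  assumes z: "z \<in> orthant" "\<And>y. y \<in> orthant \<Longrightarrow> dual z \<le> dual y" and "b \<in> Basis"
  shows "slack z \<bullet> b \<le> 0"
proof -
  have "z + b \<in> orthant" using z(1) \<open>b \<in> Basis\<close> by (auto simp: orthant_def inner_add_left inner_Basis)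
  from dual_variational[OF z this] show ?thesis by simp
qed

text \<open>
  The number \<open>p\<close> obtained here is \<open>slack y \<bullet> h\<close> for the step \<open>h\<close>. It bounds the decrease of
  \<open>dual\<close> from below, up to the curvature of the sign coordinates, because \<open>\<alpha> * \<kappa> \<le> 1\<close> makes the curvature of the gradient coordinates cost at
  most \<open>p / 2\<close>, and it bounds the gap from above, because convexity bounds the gap by the
  inner product of \<open>slack y\<close> with \<open>z - y\<close>, which the coordinatewise estimates compare with \<open>p\<close>.
\<close>

lemma one_step_progress:
  fixes \<alpha> \<beta> \<kappa> G R s0 :: real
  assumes \<kappa>: "\<kappa> > 0" "\<And>x. norm (K x) \<le> \<kappa> * norm x"
    and s0: "\<bar>s0\<bar> \<le> 1"
    and y: "y \<in> orthant" "norm y \<le> R" and z: "z \<in> orthant" "norm z \<le> R"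
    and G: "norm (slack y) \<le> G"
    and \<alpha>: "0 < \<alpha>" "\<alpha> * G \<le> R" "\<alpha> * \<kappa> \<le> 1"
    and \<beta>: "0 < \<beta>" "\<beta> \<le> R"
  obtains p where "0 \<le> p"
    "dual (ascent_step S s0 \<alpha> \<beta> y) \<le> dual y - p / 2 + \<kappa> * DIM('a) * \<beta>\<^sup>2 / 2"
    "dual y - dual z \<le> DIM('a) * (R / \<beta> * p + R * sqrt (p / \<alpha>))"
proof -
  define h where "h = ascent_step S s0 \<alpha> \<beta> y - y"
  define p where "p b = (slack y \<bullet> b) * (h \<bullet> b)" for b
  have R: "0 \<le> R" using y(2) norm_ge_zero order_trans by blast
  have coord_le: "\<bar>w \<bullet> b\<bar> \<le> r" if "b \<in> Basis" "norm w \<le> r" for w b :: 'a and r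
    using Basis_le_norm[OF that(1)] that(2) by (rule order_trans)
  have y_b: "0 \<le> y \<bullet> b" "y \<bullet> b \<le> R" and z_b: "0 \<le> z \<bullet> b" "z \<bullet> b \<le> R"
    and g_b: "\<bar>slack y \<bullet> b\<bar> \<le> G" if b: "b \<in> Basis" for b
    using coord_le[OF b y(2)] coord_le[OF b z(2)] coord_le[OF b G] y(1) z(1) b
    by (auto simp: orthant_def)
  have coord: "0 \<le> p b \<and> (h \<bullet> b)\<^sup>2 \<le> \<alpha> * p b + \<beta>\<^sup>2 \<and>
      (slack y \<bullet> b) * (z \<bullet> b - y \<bullet> b) \<le> R / \<beta> * p b + R * sqrt (p b / \<alpha>)"
    if b: "b \<in> Basis" for b
  proof (cases "b \<in> S")
    case True
    have h: "h \<bullet> b = max 0 (y \<bullet> b + \<beta> * sign_with s0 (slack y \<bullet> b)) - y \<bullet> b"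
      using True b by (simp add: h_def inner_diff_left ascent_step_inner)
    note * = projected_sign_coordinate[OF y_b[OF b] z_b[OF b] \<beta> s0, of "slack y \<bullet> b", folded h]
    have "0 \<le> p b" using *(2) by (simp add: p_def)
    moreover have "(h \<bullet> b)\<^sup>2 \<le> \<beta>\<^sup>2" using *(1) \<beta> by (metis abs_le_square_iff abs_of_pos)
    moreover have "0 \<le> \<alpha> * p b" "0 \<le> R * sqrt (p b / \<alpha>)" using \<alpha>(1) R \<open>0 \<le> p b\<close> by auto
    ultimately show ?thesis using *(3) unfolding p_def by linarith
  next
    case False
    have h: "h \<bullet> b = max 0 (y \<bullet> b + \<alpha> * (slack y \<bullet> b)) - y \<bullet> b"
      using False b by (simp add: h_def inner_diff_left ascent_step_inner)
    note * = projected_gradient_coordinate[OF y_b[OF b] z_b[OF b] g_b[OF b] \<alpha>(1,2), folded h]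
    have "0 \<le> \<alpha> * p b" using *(1) unfolding p_def by (rule order_trans[rotated]) simp
    then have "0 \<le> p b" using \<alpha>(1) by (simp add: zero_le_mult_iff)
    moreover have "0 \<le> R / \<beta> * p b" using R \<beta>(1) \<open>0 \<le> p b\<close> by simp
    moreover have "0 \<le> \<beta>\<^sup>2" by simp
    ultimately show ?thesis using *(1,2) unfolding p_def by linarith
  qed
  define P where "P = (\<Sum>b\<in>Basis. p b)"
  have P: "P = slack y \<bullet> h" unfolding P_def p_def by (rule euclidean_inner[symmetric])
  have "0 \<le> P" unfolding P_def using coord by (intro sum_nonneg) auto
  have p_le: "p b \<le> P" if "b \<in> Basis" for b
    unfolding P_def using that coord by (intro member_le_sum) auto
  have "h \<bullet> h = (\<Sum>b\<in>Basis. (h \<bullet> b)\<^sup>2)" by (subst euclidean_inner) (simp add: power2_eq_square)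
  also have "\<dots> \<le> (\<Sum>b\<in>Basis. \<alpha> * p b + \<beta>\<^sup>2)" using coord by (intro sum_mono) auto
  also have "\<dots> = \<alpha> * P + DIM('a) * \<beta>\<^sup>2" by (simp add: P_def sum.distrib sum_distrib_left)
  finally have hh: "h \<bullet> h \<le> \<alpha> * P + DIM('a) * \<beta>\<^sup>2" .
  have "h \<bullet> K h \<le> norm h * norm (K h)" by (rule norm_cauchy_schwarz)
  also have "\<dots> \<le> norm h * (\<kappa> * norm h)" using \<kappa> by (intro mult_left_mono) auto
  also have "\<dots> = \<kappa> * (h \<bullet> h)" by (simp add: power2_norm_eq_inner[symmetric] power2_eq_square)
  also have "\<dots> \<le> \<kappa> * (\<alpha> * P + DIM('a) * \<beta>\<^sup>2)" using hh \<kappa>(1) by simp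
  also have "\<dots> = (\<alpha> * \<kappa>) * P + \<kappa> * DIM('a) * \<beta>\<^sup>2" by (simp add: algebra_simps)
  also have "\<dots> \<le> P + \<kappa> * DIM('a) * \<beta>\<^sup>2" using mult_right_mono[OF \<alpha>(3) \<open>0 \<le> P\<close>] by simp
  finally have "h \<bullet> K h \<le> P + \<kappa> * DIM('a) * \<beta>\<^sup>2" .
  then have "dual (ascent_step S s0 \<alpha> \<beta> y) \<le> dual y - P / 2 + \<kappa> * DIM('a) * \<beta>\<^sup>2 / 2"
    using dual_expand[of y h] P by (simp add: h_def)
  moreover have "dual y - dual z \<le> DIM('a) * (R / \<beta> * P + R * sqrt (P / \<alpha>))"
  proof -
    have "dual y - dual z \<le> slack y \<bullet> (z - y)" by (rule dual_convex)
    also have "\<dots> = (\<Sum>b\<in>Basis. (slack y \<bullet> b) * (z \<bullet> b - y \<bullet> b))"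
      by (subst euclidean_inner) (simp add: inner_diff_left)
    also have "\<dots> \<le> (\<Sum>b\<in>(Basis::'a set). R / \<beta> * P + R * sqrt (P / \<alpha>))"
    proof (rule sum_mono)
      fix b :: 'a assume b: "b \<in> Basis"
      have "R / \<beta> * p b + R * sqrt (p b / \<alpha>) \<le> R / \<beta> * P + R * sqrt (P / \<alpha>)"
        using R \<alpha>(1) \<beta>(1) p_le[OF b]
        by (intro add_mono mult_left_mono real_sqrt_le_mono divide_right_mono) auto
      with coord[OF b] show "(slack y \<bullet> b) * (z \<bullet> b - y \<bullet> b) \<le> R / \<beta> * P + R * sqrt (P / \<alpha>)"
        by linarith
    qed
    also have "\<dots> = DIM('a) * (R / \<beta> * P + R * sqrt (P / \<alpha>))" by simp
    finally show ?thesis .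
  qed
  ultimately show ?thesis using that \<open>0 \<le> P\<close> by blast
qed

text \<open>
  The step-size \<open>\<alpha>\<close> depends only on the problem, and only \<open>\<beta>\<close> must shrink with \<open>\<epsilon>\<close>. The bounds \<open>R\<close>
  and \<open>G\<close> refer to the sublevel set of level \<open>1\<close>, which the iteration never leaves: it starts with
  the value \<open>0\<close>, and any increase ends below the minimum plus \<open>\<rho>\<close>, where the minimum is at most \<open>0\<close>
  and \<open>\<rho> \<le> 1\<close>. This makes the constants available before the step-sizes are chosen.
\<close>

theorem ascent_eventually_near_feasible_slack:
  fixes \<epsilon> s0 :: real
  assumes "\<epsilon> > 0" and s0: "\<bar>s0\<bar> \<le> 1"
  shows "\<exists>\<alpha> > 0. \<exists>\<beta> > 0. \<exists>T w. (\<forall>b\<in>Basis. slack w \<bullet> b \<le> 0) \<and>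
    (\<forall>t \<ge> T. norm (slack ((ascent_step S s0 \<alpha> \<beta> ^^ t) 0) - slack w) \<le> \<epsilon>)"
proof -
  obtain \<kappa> where \<kappa>: "\<kappa> > 0" "\<And>x. norm (K x) \<le> \<kappa> * norm x" by (rule K_bound) blast
  obtain \<delta> C where \<delta>: "\<delta> > 0" and coercive: "\<And>y. y \<in> orthant \<Longrightarrow> \<delta> * norm y - C \<le> dual y"
    by (rule dual_coercive) blast
  obtain z where z: "z \<in> orthant" "\<And>y. y \<in> orthant \<Longrightarrow> dual z \<le> dual y"
    by (rule dual_minimizer) blast
  have zero: "0 \<in> orthant" "dual 0 = 0" by (auto simp: orthant_def dual_def)
  have "C \<ge> 0" using coercive[OF zero(1)] zero(2) by simp
  have dual_z: "dual z \<le> 0" using z(2)[OF zero(1)] zero(2) by simp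

  define R where "R = (1 + C) / \<delta>"
  define G where "G = norm c + \<kappa> * R"
  have R: "R > 0" using \<delta> \<open>C \<ge> 0\<close> by (simp add: R_def)
  then have G: "G > 0" using \<kappa>(1) by (simp add: G_def add_nonneg_pos)
  have norm_le: "norm y \<le> R" if "y \<in> orthant" "dual y \<le> 1" for y
    using coercive[OF that(1)] that(2) \<delta> by (simp add: R_def field_simps)
  have slack_le: "norm (slack y) \<le> G" if "norm y \<le> R" for y
  proof -
    have "norm (slack y) \<le> norm c + norm (K y)" unfolding slack_def by (rule norm_triangle_ineq4)
    also have "norm (K y) \<le> \<kappa> * R"
      using \<kappa>(2)[of y] mult_left_mono[OF that, of \<kappa>] \<kappa>(1) by linarith
    finally show ?thesis by (simp add: G_def)
  qed

  define \<alpha> where "\<alpha> = min (1 / \<kappa>) (R / G)"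
  have \<alpha>: "0 < \<alpha>" "\<alpha> * G \<le> R" "\<alpha> * \<kappa> \<le> 1"
  proof -
    show "0 < \<alpha>" using \<kappa>(1) R G by (simp add: \<alpha>_def)
    have "\<alpha> \<le> R / G" "\<alpha> \<le> 1 / \<kappa>" by (simp_all add: \<alpha>_def)
    then show "\<alpha> * G \<le> R" "\<alpha> * \<kappa> \<le> 1" using G \<kappa>(1) by (simp_all add: field_simps)
  qed
  define M where "M = real DIM('a)"
  \<comment> \<open>\<open>p \<ge> m * \<beta>\<^sup>2\<close> outweighs the curvature error and leaves a decrease of \<open>\<beta>\<^sup>2\<close>;
    \<open>D * \<beta>\<close> bounds the gap whenever \<open>p\<close> is smaller\<close>
  define m where "m = \<kappa> * M + 2"
  define D where "D = M * (R * m + R * sqrt (m / \<alpha>))"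
  \<comment> \<open>a gap of at most \<open>\<rho>\<close> keeps the slack within \<open>\<epsilon>\<close> of that of the minimizer\<close>
  define \<rho> where "\<rho> = min 1 (\<epsilon>\<^sup>2 / (2 * \<kappa>))"
  define \<beta> where "\<beta> = min (min R 1) (\<rho> / (D + \<kappa> * M / 2))"
  have M: "M > 0" by (simp add: M_def)
  then have m: "m > 0" using \<kappa>(1) by (simp add: m_def add_pos_pos)
  have D: "D > 0" unfolding D_def using M R m \<alpha>(1) by (intro mult_pos_pos add_pos_pos) auto
  have \<rho>: "0 < \<rho>" "\<rho> \<le> 1" using \<open>\<epsilon> > 0\<close> \<kappa>(1) by (auto simp: \<rho>_def)
  have D': "0 < D + \<kappa> * M / 2" using D \<kappa>(1) M by (simp add: add_pos_pos)
  have \<beta>: "0 < \<beta>" "\<beta> \<le> R" "\<beta> \<le> 1" using R \<rho>(1) D' by (auto simp: \<beta>_def)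
  have "\<beta> \<le> \<rho> / (D + \<kappa> * M / 2)" by (simp add: \<beta>_def)
  then have "(D + \<kappa> * M / 2) * \<beta> \<le> \<rho>" using D' by (simp add: field_simps)
  moreover have "\<kappa> * M * \<beta>\<^sup>2 \<le> \<kappa> * M * \<beta>"
    using \<beta> \<kappa>(1) M by (intro mult_left_mono) (auto simp: power2_eq_square mult_left_le)
  ultimately have \<beta>_small: "D * \<beta> + \<kappa> * M * \<beta>\<^sup>2 / 2 \<le> \<rho>" by (simp add: algebra_simps)

  let ?F = "ascent_step S s0 \<alpha> \<beta>"
  have step: "(dual z + D * \<beta> < dual y \<longrightarrow> dual (?F y) \<le> dual y - \<beta>\<^sup>2) \<and>
      (dual y \<le> dual z + D * \<beta> \<longrightarrow> dual (?F y) \<le> dual z + \<rho>)"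
    if y: "y \<in> orthant" "dual y \<le> 1" for y
  proof -
    obtain p where p: "0 \<le> p" "dual (?F y) \<le> dual y - p / 2 + \<kappa> * M * \<beta>\<^sup>2 / 2"
        "dual y - dual z \<le> M * (R / \<beta> * p + R * sqrt (p / \<alpha>))"
      using one_step_progress[OF \<kappa> s0 y(1) norm_le[OF y] z(1) norm_le[OF z(1)]
          slack_le[OF norm_le[OF y]] \<alpha> \<beta>(1,2), of S] dual_z unfolding M_def by auto
    have "m * \<beta>\<^sup>2 \<le> p" if far: "dual z + D * \<beta> < dual y"
    proof (rule ccontr)
      assume "\<not> ?thesis"
      then have "p \<le> m * \<beta>\<^sup>2" by simp
      then have "R / \<beta> * p + R * sqrt (p / \<alpha>) \<le> R / \<beta> * (m * \<beta>\<^sup>2) + R * sqrt (m * \<beta>\<^sup>2 / \<alpha>)"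
        using R \<beta>(1) \<alpha>(1)
        by (intro add_mono mult_left_mono real_sqrt_le_mono divide_right_mono) auto
      also have "sqrt (m * \<beta>\<^sup>2 / \<alpha>) = sqrt (m / \<alpha> * \<beta>\<^sup>2)" by simp
      also have "\<dots> = sqrt (m / \<alpha>) * \<beta>" using \<beta>(1) by (simp only: real_sqrt_mult) simp
      also have "R / \<beta> * (m * \<beta>\<^sup>2) + R * (sqrt (m / \<alpha>) * \<beta>) = (R * m + R * sqrt (m / \<alpha>)) * \<beta>"
        using \<beta>(1) by (simp add: field_simps power2_eq_square)
      finally have "M * (R / \<beta> * p + R * sqrt (p / \<alpha>)) \<le> M * ((R * m + R * sqrt (m / \<alpha>)) * \<beta>)"
        using M by simp
      also have "\<dots> = D * \<beta>" by (simp add: D_def)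
      finally show False using p(3) far by simp
    qed
    then show ?thesis using p(1,2) \<beta>_small by (auto simp: m_def algebra_simps)
  qed

  define y where "y t = (?F ^^ t) 0" for t
  have y_Suc: "y (Suc t) = ?F (y t)" for t by (simp add: y_def)
  have inv: "y t \<in> orthant \<and> dual (y t) \<le> 1" for t
  proof (induction t)
    case 0
    show ?case using zero by (simp add: y_def)
  next
    case (Suc t)
    have "?F (y t) \<in> orthant" by (simp add: orthant_def ascent_step_inner)
    moreover have "dual (y t) - \<beta>\<^sup>2 \<le> 1"
      using conjunct2[OF Suc] zero_le_power2[of \<beta>] by linarith
    then have "dual (?F (y t)) \<le> 1"
      using step[of "y t"] Suc dual_z \<rho>(2)
      by (cases "dual z + D * \<beta> < dual (y t)") auto
    ultimately show ?case by (simp add: y_Suc)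
  qed
  have "\<exists>T. \<forall>t \<ge> T. dual (y t) \<le> dual z + \<rho>"
  proof (rule eventually_below_threshold)
    show "dual z \<le> dual (y t)" for t using inv z(2) by simp
    show "0 < \<beta>\<^sup>2" using \<beta>(1) by simp
    have "0 \<le> \<kappa> * M * \<beta>\<^sup>2 / 2" using \<kappa>(1) M by simp
    then show "dual z + D * \<beta> \<le> dual z + \<rho>" using \<beta>_small by linarith
  qed (use step inv y_Suc in auto)
  then obtain T where T: "\<And>t. t \<ge> T \<Longrightarrow> dual (y t) \<le> dual z + \<rho>" by blast
  have "norm (slack (y t) - slack z) \<le> \<epsilon>" if "t \<ge> T" for t
  proof -
    have "(norm (K (y t - z)))\<^sup>2 \<le> \<kappa> * ((y t - z) \<bullet> K (y t - z))" by (rule norm_K_sq_le[OF \<kappa>])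
    also have "\<dots> \<le> \<kappa> * (2 * (dual (y t) - dual z))"
      using \<kappa>(1) inv[of t] dual_gap_quadratic[OF z, of "y t"] by (intro mult_left_mono) auto
    also have "\<dots> \<le> \<kappa> * (2 * (\<epsilon>\<^sup>2 / (2 * \<kappa>)))"
      using T[OF that] \<kappa>(1) by (intro mult_left_mono) (auto simp: \<rho>_def)
    also have "\<dots> = \<epsilon>\<^sup>2" using \<kappa>(1) by simp
    finally have "norm (K (y t - z)) \<le> \<epsilon>" using \<open>\<epsilon> > 0\<close> by (simp add: power2_le_iff_abs_le)
    moreover have "slack (y t) - slack z = - K (y t - z)"
      by (simp add: slack_def linear_diff[OF linear_K])
    ultimately show ?thesis by simp
  qed
  then show ?thesis using \<alpha>(1) \<beta>(1) slack_minimizer_nonpos[OF z] unfolding y_def by blast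
qed

end

section \<open>Positive definiteness of the reactance matrix of a tree\<close>

lemma network_simps [simp]:
  "verts (network E) = UNIV" "arcs (network E) = E"
  "tail (network E) = fst" "head (network E) = snd"
  by (simp_all add: network_def)

text \<open>
  A walk from the root can be shortened to a path with the same ends, and the walk is unique, so
  the path selected in the definition of \<open>path_edges\<close> is the unique walk.
\<close>

lemma tree_paths:
  fixes E :: "('n option \<times> 'n option) set"
  assumes tree: "rooted_tree (network E) None"
  obtains P where "\<And>i. pre_digraph.awalk (network E) None (P i) (Some i)"
    and "\<And>i p. pre_digraph.awalk (network E) None p (Some i) \<Longrightarrow> p = P i"
    and "\<And>i. path_edges E i = set (P i)"
proof -
  interpret wf_digraph "network E" using tree by (simp add: rooted_tree_def)
  define P where "P i = (THE p. apath None p (Some i))" for i :: 'n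
  have unique: "\<exists>!p. awalk None p (Some i)" for i
    using tree by (simp add: rooted_tree_def)
  have "\<exists>p. apath None p (Some i)" for i
    using unique[of i] apath_awalk_to_apath by blast
  then have "\<exists>!p. apath None p (Some i)" for i
    using unique[of i] unfolding apath_def by blast
  then have walk: "awalk None (P i) (Some i)" for i
    using theI'[of "\<lambda>p. apath None p (Some i)"] unfolding P_def apath_def by blast
  show thesis
  proof (rule that)
    show "awalk None (P i) (Some i)" for i by (rule walk)
    show "p = P i" if "awalk None p (Some i)" for i p using that walk unique by blast
    show "path_edges E i = set (P i)" for i by (simp add: path_edges_def P_def)
  qed
qed

text \<open>
  The depth is the length of the path from the root, and the edge in question is the last one on
  the path to \<open>i\<close>. A path to \<open>j\<close> that uses this edge visits \<open>i\<close> right after it, so by uniqueness it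
  extends the path to \<open>i\<close>, properly if \<open>j\<close> differs from \<open>i\<close>.
\<close>

lemma tree_depth:
  fixes E :: "('n option \<times> 'n option) set"
  assumes tree: "rooted_tree (network E) None"
  obtains depth :: "'n \<Rightarrow> nat" where "\<And>i. path_edges E i \<subseteq> E"
    and "\<And>i. \<exists>e \<in> path_edges E i. \<forall>j. e \<in> path_edges E j \<longrightarrow> j \<noteq> i \<longrightarrow> depth i < depth j"
proof -
  interpret wf_digraph "network E" using tree by (simp add: rooted_tree_def)
  obtain P where walk: "\<And>i. awalk None (P i) (Some i)"
    and unique: "\<And>i p. awalk None p (Some i) \<Longrightarrow> p = P i"
    and edges: "\<And>i. path_edges E i = set (P i)"
    using tree_paths[OF tree] by blast
  show thesis
  proof (rule that[of "\<lambda>i. length (P i)"])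
    show "path_edges E i \<subseteq> E" for i using walk[of i] by (auto simp: awalk_def edges)
    fix i
    have "P i \<noteq> []" using walk[of i] by (auto simp: awalk_Nil_iff)
    then obtain p e where pe: "P i = p @ [e]" by (metis rev_exhaust)
    have head: "snd e = Some i" using walk[of i] unfolding pe awalk_def by (auto simp: cas_simp)
    have "length (P i) < length (P j)" if e: "e \<in> set (P j)" and "j \<noteq> i" for j
    proof -
      obtain p1 p2 where split: "P j = p1 @ e # p2" using e by (meson split_list)
      have "awalk None ((p1 @ [e]) @ p2) (Some j)" using walk[of j] split by simp
      then have "awalk None (p1 @ [e]) (awlast None (p1 @ [e]))"
        by (simp only: awalk_append_iff)
      then have "awalk None (p1 @ [e]) (Some i)" using head by (simp add: awalk_verts_conv)
      then have prefix: "p1 @ [e] = P i" by (rule unique)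
      have "p2 \<noteq> []"
      proof
        assume "p2 = []"
        then have "P j = P i" using split prefix by simp
        then show False using awalk_ends_eqD[of None "P i" "Some i" "Some j"] walk[of i] walk[of j] \<open>j \<noteq> i\<close> by auto
      qed
      then show ?thesis using split by (simp flip: prefix)
    qed
    then show "\<exists>e \<in> path_edges E i. \<forall>j. e \<in> path_edges E j \<longrightarrow> j \<noteq> i \<longrightarrow> length (P i) < length (P j)"
      using pe by (auto simp: edges)
  qed
qed

lemma transpose_reactance_matrix: "transpose (reactance_matrix E x) = reactance_matrix E x"
  by (simp add: reactance_matrix_def transpose_def Int_commute)

text \<open>
  Exchanging the summations regroups the common edges of pairs of paths by edge; the inner sum is
  the total of \<open>z\<close> over the buses below the edge.
\<close>

lemma reactance_quadratic_form:
  fixes z :: "real^'n::finite"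
  assumes "\<And>i. path_edges E i \<subseteq> E"
  shows "z \<bullet> (reactance_matrix E x *v z) =
    2 * (\<Sum>e\<in>E. x e * (\<Sum>i | e \<in> path_edges E i. z $ i)\<^sup>2)"
proof -
  have entry: "reactance_matrix E x $ i $ j =
      2 * (\<Sum>e\<in>E. x e * (of_bool (e \<in> path_edges E i) * of_bool (e \<in> path_edges E j)))" for i j :: 'n
  proof -
    have "(\<Sum>e\<in>path_edges E i \<inter> path_edges E j. x e) =
        (\<Sum>e\<in>E. if e \<in> path_edges E i \<inter> path_edges E j then x e else 0)"
      using assms by (subst sum.inter_restrict[symmetric]) (auto intro!: sum.cong)
    also have "\<dots> = (\<Sum>e\<in>E. x e * (of_bool (e \<in> path_edges E i) * of_bool (e \<in> path_edges E j)))"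
      by (intro sum.cong) auto
    finally show ?thesis by (simp add: reactance_matrix_def)
  qed
  have flow: "(\<Sum>i | e \<in> path_edges E i. z $ i) = (\<Sum>i\<in>UNIV. of_bool (e \<in> path_edges E i) * z $ i)" for e
    by (simp add: sum.If_cases of_bool_def if_distrib[of "\<lambda>a. a * _"] cong: if_cong)
  have "z \<bullet> (reactance_matrix E x *v z) = (\<Sum>i\<in>UNIV. \<Sum>j\<in>UNIV. \<Sum>e\<in>E.
      2 * x e * ((of_bool (e \<in> path_edges E i) * z $ i) * (of_bool (e \<in> path_edges E j) * z $ j)))"
    by (simp add: inner_vec_def matrix_vector_mult_def entry sum_distrib_left sum_distrib_right mult_ac)
  also have "\<dots> = (\<Sum>i\<in>UNIV. \<Sum>e\<in>E. \<Sum>j\<in>UNIV.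
      2 * x e * ((of_bool (e \<in> path_edges E i) * z $ i) * (of_bool (e \<in> path_edges E j) * z $ j)))"
    by (intro sum.cong refl sum.swap)
  also have "\<dots> = (\<Sum>e\<in>E. \<Sum>i\<in>UNIV. \<Sum>j\<in>UNIV.
      2 * x e * ((of_bool (e \<in> path_edges E i) * z $ i) * (of_bool (e \<in> path_edges E j) * z $ j)))"
    by (rule sum.swap)
  also have "\<dots> = 2 * (\<Sum>e\<in>E. x e * (\<Sum>i | e \<in> path_edges E i. z $ i)\<^sup>2)"
    unfolding flow power2_eq_square sum_product
    by (simp only: sum_distrib_left mult.assoc)
  finally show ?thesis .
qed

text \<open>
  Among the buses with a nonzero entry of \<open>z\<close> choose one of maximal depth. All other buses below
  its incoming edge are deeper and hence have the entry \<open>0\<close>, so this edge alone makes the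
  quadratic form positive.
\<close>

lemma reactance_matrix_pos_def:
  fixes E :: "('n::finite option \<times> 'n option) set" and z :: "real^'n"
  assumes tree: "rooted_tree (network E) None" and pos: "\<And>e. e \<in> E \<Longrightarrow> x e > 0" and "z \<noteq> 0"
  shows "0 < z \<bullet> (reactance_matrix E x *v z)"
proof -
  obtain depth :: "'n \<Rightarrow> nat" where sub: "\<And>i. path_edges E i \<subseteq> E"
    and last_edge: "\<And>i. \<exists>e \<in> path_edges E i. \<forall>j. e \<in> path_edges E j \<longrightarrow> j \<noteq> i \<longrightarrow> depth i < depth j"
    using tree_depth[OF tree] by blast
  let ?Z = "{i. z $ i \<noteq> 0}"
  have "?Z \<noteq> {}" using \<open>z \<noteq> 0\<close> by (auto simp: vec_eq_iff)
  then have "Max (depth ` ?Z) \<in> depth ` ?Z" by (intro Max_in) auto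
  then obtain i where i: "z $ i \<noteq> 0" "depth i = Max (depth ` ?Z)" by auto
  have deepest: "depth j \<le> depth i" if "z $ j \<noteq> 0" for j
    unfolding i(2) using that by (intro Max_ge) auto
  obtain e where e: "e \<in> path_edges E i"
    and below: "\<And>j. e \<in> path_edges E j \<Longrightarrow> j \<noteq> i \<Longrightarrow> depth i < depth j"
    using last_edge[of i] by blast
  have "(\<Sum>j | e \<in> path_edges E j. z $ j) = (\<Sum>j\<in>{i}. z $ j)"
    using e below deepest by (intro sum.mono_neutral_right) (auto simp: not_le[symmetric])
  moreover have "0 < x e" using pos e sub by blast
  ultimately have "0 < x e * (\<Sum>j | e \<in> path_edges E j. z $ j)\<^sup>2"
    using i(1) by simp
  then have "0 < (\<Sum>e\<in>E. x e * (\<Sum>j | e \<in> path_edges E j. z $ j)\<^sup>2)"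
    using e sub by (intro sum_pos2[of E e] mult_nonneg_nonneg) (auto intro: less_imp_le[OF pos])
  then show ?thesis by (simp add: reactance_quadratic_form[OF sub])
qed

section \<open>The dual of the voltage regulation problem\<close>

type_synonym 'n stacked = "((real^'n) \<times> (real^'n)) \<times> ((real^'n) \<times> (real^'n))"

text \<open>
  The abstract ascent runs in one Euclidean space. In this nested product the inner product is the
  sum over the four multiplier vectors, and the basis consists of their coordinate vectors.
\<close>

definition stack :: "'n::finite duals \<Rightarrow> 'n stacked"
  where "stack s = ((lam_min s, lam_max s), (mu_min s, mu_max s))"

definition unstack :: "'n::finite stacked \<Rightarrow> 'n duals"
  where "unstack y = \<lparr>lam_min = fst (fst y), lam_max = snd (fst y),
    mu_min = fst (snd y), mu_max = snd (snd y)\<rparr>"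

lemma unstack_stack [simp]: "unstack (stack s) = s"
  by (simp add: stack_def unstack_def)

definition injection :: "real^'n^'n \<Rightarrow> 'n::finite stacked \<Rightarrow> real^'n"
  where "injection A y = vclb_q A (unstack y)"

text \<open>
  The constraints depend on the multipliers only through the injection \<open>q\<close> and through \<open>A q\<close>; this
  dependence is the Hessian of the dual, since the gradient of the dual consists of the
  constraint values.
\<close>

definition dual_hessian :: "real^'n^'n \<Rightarrow> 'n::finite stacked \<Rightarrow> 'n stacked"
  where "dual_hessian A y =
    ((A *v injection A y, - (A *v injection A y)), (injection A y, - injection A y))"

definition dual_bounds :: "real^'n \<Rightarrow> real^'n \<Rightarrow> real^'n \<Rightarrow> real^'n \<Rightarrow> real^'n \<Rightarrow> 'n::finite stacked"
  where "dual_bounds d vmin vmax qmin qmax = ((vmin - d, d - vmax), (qmin, - qmax))"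

lemma linear_injection: "linear (injection A)"
  by (rule linearI)
    (simp_all add: injection_def vclb_q_def unstack_def matrix_vector_right_distrib
      matrix_vector_mult_diff_distrib matrix_vector_mult_scaleR algebra_simps)

text \<open>
  A positive definite matrix has a trivial kernel.
\<close>

lemma matrix_inv_pos_def:
  fixes A :: "real^'n^'n"
  assumes "\<And>z. z \<noteq> 0 \<Longrightarrow> 0 < z \<bullet> (A *v z)"
  shows "A ** matrix_inv A = mat 1"
proof -
  have "x = 0" if "A *v x = 0" for x using assms[of x] that by force
  then have "invertible A"
    by (auto simp: invertible_left_inverse matrix_left_invertible_ker)
  then show ?thesis unfolding invertible_def matrix_inv_def by (rule someI2_ex) blast
qed

text \<open>
  The bilinear form of \<open>K\<close> is the pairing of two injections with respect to \<open>A\<close>, which explains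
  symmetry and semidefiniteness. A strictly feasible \<open>q\<close> is itself the injection of the
  multipliers whose only nonzero part is \<open>lam_min = q\<close>.
\<close>

lemma convex_dual_quadratic_vclb:
  fixes A :: "real^'n^'n" and d vmin vmax qmin qmax :: "real^'n"
  assumes sym: "transpose A = A" and pos_def: "\<And>z. z \<noteq> 0 \<Longrightarrow> 0 < z \<bullet> (A *v z)"
    and strict: "q \<in> box qmin qmax" "voltage A d q \<in> box vmin vmax"
  shows "convex_dual_quadratic (dual_hessian A) (dual_bounds d vmin vmax qmin qmax)"
proof (rule convex_dual_quadratic.intro)

  have self: "u \<bullet> (A *v w) = (A *v u) \<bullet> w" for u w
    using dot_lmul_matrix[of u A w] sym by (metis transpose_matrix_vector)
  have energy: "x \<bullet> dual_hessian A y = (A *v injection A x) \<bullet> injection A y" for x y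
  proof -
    have "A *v (matrix_inv A *v u) = u" for u
      by (simp add: matrix_vector_mul_assoc matrix_inv_pos_def[OF pos_def])
    then have "A *v injection A x = A *v (fst (fst x) - snd (fst x)) + (fst (snd x) - snd (snd x))"
      by (simp add: injection_def vclb_q_def unstack_def matrix_vector_right_distrib)
    then show ?thesis
      by (cases x) (auto simp: dual_hessian_def self inner_simps matrix_vector_mult_diff_distrib)
  qed
  show "linear (dual_hessian A)"
    by (rule linearI)
      (simp_all add: dual_hessian_def linear_add[OF linear_injection] linear_scale[OF linear_injection]
        matrix_vector_right_distrib matrix_vector_mult_scaleR)
  show "x \<bullet> dual_hessian A y = dual_hessian A x \<bullet> y" for x y
    using energy[of x y] energy[of y x] self[of "injection A y" "injection A x"]
    by (simp add: inner_commute)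
  show "0 \<le> x \<bullet> dual_hessian A x" for x
    unfolding energy using pos_def[of "injection A x"]
    by (cases "injection A x = 0") (auto simp: inner_commute)
  let ?y = "((q, 0), (0, 0)) :: 'n stacked"
  have "injection A ?y = q" by (simp add: injection_def vclb_q_def unstack_def)
  then have slack: "dual_bounds d vmin vmax qmin qmax - dual_hessian A ?y =
      ((vmin - voltage A d q, voltage A d q - vmax), (qmin - q, q - qmax))"
    by (simp add: dual_bounds_def dual_hessian_def voltage_def)
  have "(dual_bounds d vmin vmax qmin qmax - dual_hessian A ?y) \<bullet> b < 0" if "b \<in> Basis" for b
    unfolding slack using that strict
    by (auto simp: Basis_prod_def Basis_vec_def inner_axis mem_box_cart)
  then show "\<exists>y. \<forall>b\<in>Basis. (dual_bounds d vmin vmax qmin qmax - dual_hessian A y) \<bullet> b < 0" by blast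
qed

text \<open>
  Stacking the multipliers turns one round of the algorithm into \<open>ascent_step\<close>, whose sign
  coordinates are the basis vectors of the \<open>\<mu>\<close> part, those with vanishing first component. The
  slack vector contains the injection and the voltage up to signs and constants, so differences
  of slack vectors dominate distances between pairs of injection and voltage.
\<close>

theorem vclb_eventually_near_feasible:
  fixes A :: "real^'n^'n" and d vmin vmax qmin qmax :: "real^'n" and s0 \<epsilon> :: real
  assumes sym: "transpose A = A" and pos_def: "\<And>z. z \<noteq> 0 \<Longrightarrow> 0 < z \<bullet> (A *v z)"
    and strict: "q \<in> box qmin qmax" "voltage A d q \<in> box vmin vmax"
    and s0: "\<bar>s0\<bar> \<le> 1" and "\<epsilon> > 0"
  shows "\<exists>\<alpha> > 0. \<exists>\<beta> > 0. \<exists>T::nat. \<forall>t \<ge> T.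
    fes A d vmin vmax qmin qmax (vclb_iterate A d vmin vmax qmin qmax s0 \<alpha> \<beta> t) \<le> \<epsilon>"
proof -
  interpret convex_dual_quadratic "dual_hessian A" "dual_bounds d vmin vmax qmin qmax"
    by (rule convex_dual_quadratic_vclb[OF sym pos_def strict])
  let ?q = "injection A" and ?v = "\<lambda>y. voltage A d (injection A y)"
  have slack: "slack y = ((vmin - ?v y, ?v y - vmax), (qmin - ?q y, ?q y - qmax))" for y
    unfolding slack_def by (simp add: dual_bounds_def dual_hessian_def voltage_def)
  define S :: "'n stacked set" where "S = {b. fst b = 0}"
  have step: "stack (vclb_step A d vmin vmax qmin qmax s0 \<alpha> \<beta> s) = ascent_step S s0 \<alpha> \<beta> (stack s)"
    for \<alpha> \<beta> s
  proof (rule euclidean_eqI)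
    fix b :: "'n stacked" assume b: "b \<in> Basis"
    have q: "injection A (stack s) = vclb_q A s" by (simp add: injection_def)
    show "stack (vclb_step A d vmin vmax qmin qmax s0 \<alpha> \<beta> s) \<bullet> b = ascent_step S s0 \<alpha> \<beta> (stack s) \<bullet> b"
      unfolding ascent_step_inner[OF b] slack q using b
      by (auto simp: stack_def vclb_step_def Let_def S_def Basis_prod_def Basis_vec_def inner_axis
          proj_nonneg_def sign_vec_def sign_with_def zero_prod_def axis_eq_0_iff)
  qed
  have iterate: "stack (vclb_duals A d vmin vmax qmin qmax s0 \<alpha> \<beta> t) = (ascent_step S s0 \<alpha> \<beta> ^^ t) 0"
    for \<alpha> \<beta> t
    by (induction t) (simp_all add: step, simp add: stack_def zero_prod_def)
  have near: "fes A d vmin vmax qmin qmax (?q y) \<le> norm (slack y - slack w)"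
    if w: "\<forall>b\<in>Basis. slack w \<bullet> b \<le> 0" for y w
  proof -
    have "(qmin - ?q w) $ i \<le> 0 \<and> (?q w - qmax) $ i \<le> 0 \<and> (vmin - ?v w) $ i \<le> 0 \<and> (?v w - vmax) $ i \<le> 0" for i
    proof -
      have "((axis i 1, 0), 0) \<in> (Basis :: 'n stacked set)" "((0, axis i 1), 0) \<in> (Basis :: 'n stacked set)"
        "(0, (axis i 1, 0)) \<in> (Basis :: 'n stacked set)" "(0, (0, axis i 1)) \<in> (Basis :: 'n stacked set)"
        by (simp_all add: Basis_prod_def image_iff bex_Un)
      from this[THEN w[rule_format]] show ?thesis by (simp add: slack inner_axis)
    qed
    then have "(?q w, ?v w) \<in> cbox qmin qmax \<times> cbox vmin vmax" by (simp add: mem_box_cart)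
    then have "fes A d vmin vmax qmin qmax (?q y) \<le> dist (?q y, ?v y) (?q w, ?v w)"
      unfolding fes_def by (rule infdist_le)
    also have "\<dots> \<le> norm (slack y - slack w)"
      by (simp add: slack dist_norm norm_Pair norm_minus_commute[of "?q y"] norm_minus_commute[of "?v y"])
    finally show ?thesis .
  qed
  obtain \<alpha> \<beta> T w where "\<alpha> > 0" "\<beta> > 0" and w: "\<forall>b\<in>Basis. slack w \<bullet> b \<le> 0"
    and T: "\<And>t. t \<ge> T \<Longrightarrow> norm (slack ((ascent_step S s0 \<alpha> \<beta> ^^ t) 0) - slack w) \<le> \<epsilon>"
    using ascent_eventually_near_feasible_slack[OF \<open>\<epsilon> > 0\<close> s0, of S] by blast
  have "fes A d vmin vmax qmin qmax (vclb_iterate A d vmin vmax qmin qmax s0 \<alpha> \<beta> t) \<le> \<epsilon>" if "t \<ge> T" for t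
  proof -
    let ?y = "(ascent_step S s0 \<alpha> \<beta> ^^ t) 0"
    have iterate_q: "vclb_iterate A d vmin vmax qmin qmax s0 \<alpha> \<beta> t = ?q ?y"
      unfolding vclb_iterate_def injection_def iterate[symmetric] by simp
    show ?thesis unfolding iterate_q by (rule order_trans[OF near[OF w] T[OF that]])
  qed
  then show ?thesis using \<open>\<alpha> > 0\<close> \<open>\<beta> > 0\<close> by blast
qed

theorem theorem2:
  fixes E :: "('n::finite option \<times> 'n option) set"
    and x :: "'n option \<times> 'n option \<Rightarrow> real"
    and A :: "real^'n^'n"
    and d vmin vmax qmin qmax :: "real^'n"
    and s0 \<epsilon> :: real
  assumes tree: "rooted_tree (network E) None"
    and reactance_pos: "\<And>e. e \<in> E \<Longrightarrow> x e > 0"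
    and A_def: "A = reactance_matrix E x"
    and sign_zero: "s0 \<in> {-1, 1}"
    and strictly_feasible: "\<exists>q. q \<in> box qmin qmax \<and> voltage A d q \<in> box vmin vmax"
    and eps_pos: "\<epsilon> > 0"
  shows "\<exists>\<alpha> > 0. \<exists>\<beta> > 0. \<exists>T::nat. \<forall>t \<ge> T.
    fes A d vmin vmax qmin qmax (vclb_iterate A d vmin vmax qmin qmax s0 \<alpha> \<beta> t) \<le> \<epsilon>"
proof -
  obtain q where strict: "q \<in> box qmin qmax" "voltage A d q \<in> box vmin vmax"
    using strictly_feasible by blast
  have sym: "transpose A = A" unfolding A_def by (rule transpose_reactance_matrix)
  have pos_def: "0 < z \<bullet> (A *v z)" if "z \<noteq> 0" for z
    unfolding A_def using tree reactance_pos that by (rule reactance_matrix_pos_def)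
  have "\<bar>s0\<bar> \<le> 1" using sign_zero by auto
  from vclb_eventually_near_feasible[OF sym pos_def strict this eps_pos] show ?thesis .
qed

end
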